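(* Let $n$ be a non-negative integer. For all increasing Boolean functions $f,g:\{0,1\}^n\to\{0,1\}$, $$\mathrm{Cov}(f,g)\ \ge\ 4\sum_{\varnothing\neq S\subseteq[n]}|S|\,\hat f(S)^2\,\hat g(S)^2 .$$
   Context: The cube $\{0,1\}^n$ carries the uniform probability measure, and $\mathbb{E}$ denotes expectation with respect to it. $\mathrm{Cov}(f,g):=\mathbb{E}[fg]-\mathbb{E}[f]\mathbb{E}[g]$. A function on $\{0,1\}^n$ is increasing if it is (weakly) increasing with respect to the coordinatewise order. $[n]=\{1,\dots,n\}$. For $S\subseteq[n]$, $\chi_S(x):=(-1)^{\sum_{i\in S}x_i}$ and $\hat f(S):=\mathbb{E}[f\chi_S]$ is the Fourier--Walsh coefficient of $f$. *)

theory Defs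
  imports "HOL-Probability.Probability"
begin

text \<open>
  A point of the cube is an extensional function: it takes the value \<open>undefined\<close> outside
  \<open>{1..n}\<close>. Two points of \<open>cube n\<close> therefore agree off \<open>{1..n}\<close>, so the pointwise order \<open>\<le>\<close>
  of the function type restricts to the coordinatewise order, and a function is increasing
  on the cube iff it is \<open>mono_on (cube n)\<close>.
\<close>

definition cube :: "nat \<Rightarrow> (nat \<Rightarrow> nat) set" where
  "cube n = {1..n} \<rightarrow>\<^sub>E {0, 1}"

definition expect :: "nat \<Rightarrow> ((nat \<Rightarrow> nat) \<Rightarrow> real) \<Rightarrow> real" where
  "expect n f = measure_pmf.expectation (pmf_of_set (cube n)) f"

definition Cov :: "nat \<Rightarrow> ((nat \<Rightarrow> nat) \<Rightarrow> real) \<Rightarrow> ((nat \<Rightarrow> nat) \<Rightarrow> real) \<Rightarrow> real" where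
  "Cov n f g = expect n (\<lambda>x. f x * g x) - expect n f * expect n g"

definition walsh :: "nat set \<Rightarrow> (nat \<Rightarrow> nat) \<Rightarrow> real" where
  "walsh S x = (-1) ^ (\<Sum>i\<in>S. x i)"

definition fourier_coeff :: "nat \<Rightarrow> ((nat \<Rightarrow> nat) \<Rightarrow> real) \<Rightarrow> nat set \<Rightarrow> real" where
  "fourier_coeff n f S = expect n (\<lambda>x. f x * walsh S x)"

lemma mem_cube_order:
  assumes "x \<in> cube n" "y \<in> cube n"
  shows "x \<le> y \<longleftrightarrow> (\<forall>i\<in>{1..n}. x i \<le> y i)"
proof
  assume le: "\<forall>i\<in>{1..n}. x i \<le> y i"
  show "x \<le> y"
  proof (rule le_funI)
    fix i show "x i \<le> y i"
    proof (cases "i \<in> {1..n}")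
      case True
      then show ?thesis using le by blast
    next
      case False
      then have "x i = undefined" "y i = undefined"
        using assms PiE_arb unfolding cube_def by blast+
      then show ?thesis by simp
    qed
  qed
qed (simp add: le_fun_def)

lemma expect_eq_average: "expect n f = (\<Sum>x\<in>cube n. f x) / 2 ^ n"
proof -
  have "finite (cube n)" "cube n \<noteq> {}" "card (cube n) = 2 ^ n"
    by (auto simp: cube_def PiE_eq_empty_iff card_PiE numeral_2_eq_2 intro!: finite_PiE)
  then show ?thesis
    by (simp add: expect_def integral_pmf_of_set)
qed

end

theory Submission
  imports Defs
begin

text \<open>
  Induction on the dimension. Let \<open>p, q, r, s\<close> be the coefficients at \<open>S\<close> of the restrictions
  \<open>f\<^sub>0, f\<^sub>1, g\<^sub>0, g\<^sub>1\<close> of \<open>f, g\<close> to the two facets of the last coordinate. The coefficients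
  of \<open>f, g\<close> at \<open>S\<close> and at \<open>S\<close> with the last coordinate added contribute
  \<open>(p + q)\<^sup>2 (r + s)\<^sup>2 + (p - q)\<^sup>2 (r - s)\<^sup>2 = 2 ((p\<^sup>2 + q\<^sup>2) (r\<^sup>2 + s\<^sup>2) + 4 p q r s)\<close> up to scaling, so the
  induction hypothesis applies to all four pairs \<open>(f\<^sub>i, g\<^sub>j)\<close>. The mixed term \<open>4 p q r s\<close> is at
  most \<open>2 (p\<^sup>2 r\<^sup>2 + q\<^sup>2 s\<^sup>2)\<close>. For the indicators \<open>A = f\<^sub>1 - f\<^sub>0\<close> and \<open>B = g\<^sub>1 - g\<^sub>0\<close>, what is left is
  to bound twice the sum of the squared products of coefficients of \<open>A\<close> and \<open>B\<close> by
  \<open>E[A] E[B] + E[A B]\<close>. This follows from Parseval's identity and from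
  \<open>E[A B] \<ge> E[A] + E[B] - 1\<close>.
\<close>

section \<open>Averages over the cube and its two facets\<close>

lemma card_cube: "card (cube n) = 2 ^ n"
  by (simp add: cube_def card_PiE numeral_2_eq_2)

lemma fun_upd_mem_cube:
  assumes "x \<in> cube n" "v \<in> {0, 1}"
  shows "x(Suc n := v) \<in> cube (Suc n)"
  using assms by (auto simp: cube_def PiE_iff extensional_def le_Suc_eq)

lemma sum_cube_Suc:
  fixes h :: "(nat \<Rightarrow> nat) \<Rightarrow> real"
  shows "(\<Sum>x\<in>cube (Suc n). h x) = (\<Sum>x\<in>cube n. h (x(Suc n := 0)) + h (x(Suc n := 1)))"
proof -
  have "inj_on (\<lambda>(v, x). x(Suc n := v)) ({0, 1} \<times> cube n)"
    unfolding cube_def by (rule inj_combinator) simp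
  moreover have "cube (Suc n) = (\<lambda>(v, x). x(Suc n := v)) ` ({0, 1} \<times> cube n)"
    by (simp add: cube_def atLeastAtMostSuc_conv PiE_insert_eq)
  ultimately have "(\<Sum>x\<in>cube (Suc n). h x) = (\<Sum>(v, x)\<in>{0, 1} \<times> cube n. h (x(Suc n := v)))"
    by (simp add: sum.reindex case_prod_unfold)
  also have "\<dots> = (\<Sum>v\<in>{0, 1}. \<Sum>x\<in>cube n. h (x(Suc n := v)))"
    by (rule sum.cartesian_product [symmetric])
  finally show ?thesis
    by (simp add: sum.distrib)
qed

lemma expect_Suc:
  "expect (Suc n) h =
    (expect n (\<lambda>x. h (x(Suc n := 0))) + expect n (\<lambda>x. h (x(Suc n := 1)))) / 2"
  by (simp add: expect_eq_average sum_cube_Suc sum.distrib field_simps)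

lemma expect_diff: "expect n (\<lambda>x. f x - g x) = expect n f - expect n g"
  by (simp add: expect_eq_average sum_subtractf diff_divide_distrib)

lemma expect_add: "expect n (\<lambda>x. f x + g x) = expect n f + expect n g"
  by (simp add: expect_eq_average sum.distrib add_divide_distrib)

lemma expect_const: "expect n (\<lambda>_. c) = c"
  by (simp add: expect_eq_average card_cube)

lemma expect_mono:
  assumes "\<And>x. x \<in> cube n \<Longrightarrow> f x \<le> g x"
  shows "expect n f \<le> expect n g"
  using assms by (simp add: expect_eq_average divide_right_mono sum_mono)

lemma expect_cong:
  assumes "\<And>x. x \<in> cube n \<Longrightarrow> f x = g x"
  shows "expect n f = expect n g"
  using assms by (simp add: expect_eq_average)

section \<open>Walsh coefficients and Parseval's identity\<close>

lemma fourier_coeff_diff: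
  "fourier_coeff n (\<lambda>x. f x - g x) S = fourier_coeff n f S - fourier_coeff n g S"
  by (simp add: fourier_coeff_def left_diff_distrib expect_diff)

lemma walsh_fun_upd:
  assumes "S \<subseteq> {1..n}"
  shows "walsh S (x(Suc n := v)) = walsh S x"
proof -
  have "(\<Sum>i\<in>S. (x(Suc n := v)) i) = (\<Sum>i\<in>S. x i)"
    using assms by (intro sum.cong) auto
  then show ?thesis
    by (simp only: walsh_def)
qed

lemma walsh_insert_fun_upd:
  assumes "S \<subseteq> {1..n}"
  shows "walsh (insert (Suc n) S) (x(Suc n := v)) = (- 1) ^ v * walsh S x"
proof -
  have "finite S" "Suc n \<notin> S"
    using assms finite_subset by auto
  then show ?thesis
    using walsh_fun_upd [OF assms, of x v] by (simp add: walsh_def power_add)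
qed

lemma fourier_coeff_Suc:
  assumes "S \<subseteq> {1..n}"
  shows "fourier_coeff (Suc n) f S =
    (fourier_coeff n (\<lambda>x. f (x(Suc n := 0))) S + fourier_coeff n (\<lambda>x. f (x(Suc n := 1))) S) / 2"
  unfolding fourier_coeff_def expect_Suc walsh_fun_upd [OF assms] ..

lemma fourier_coeff_Suc_insert:
  assumes "S \<subseteq> {1..n}"
  shows "fourier_coeff (Suc n) f (insert (Suc n) S) =
    (fourier_coeff n (\<lambda>x. f (x(Suc n := 0))) S - fourier_coeff n (\<lambda>x. f (x(Suc n := 1))) S) / 2"
  unfolding fourier_coeff_def expect_Suc walsh_insert_fun_upd [OF assms]
  by (simp add: expect_eq_average sum_negf)

lemma sum_Pow_Suc:
  fixes h :: "nat set \<Rightarrow> real"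
  shows "(\<Sum>S\<in>Pow {1..Suc n}. h S) = (\<Sum>S\<in>Pow {1..n}. h S + h (insert (Suc n) S))"
proof -
  have "Suc n \<notin> S" if "S \<in> Pow {1..n}" for S
    using that by auto
  then have "inj_on (insert (Suc n)) (Pow {1..n})"
    by (intro inj_onI) (metis insert_ident)
  moreover have "Pow {1..n} \<inter> insert (Suc n) ` Pow {1..n} = {}"
    by auto
  ultimately show ?thesis
    by (simp add: atLeastAtMostSuc_conv Pow_insert sum.union_disjoint sum.reindex sum.distrib)
qed

text \<open>Coefficients at \<open>S\<close> and \<open>insert (Suc n) S\<close> are the half-sum
  and half-difference of those of the two restrictions, so the parallelogram law reproduces the
  recursion \<open>expect_Suc\<close>.\<close>

lemma parseval: "(\<Sum>S\<in>Pow {1..n}. (fourier_coeff n f S)\<^sup>2) = expect n (\<lambda>x. (f x)\<^sup>2)"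
proof (induction n arbitrary: f)
  case 0
  then show ?case
    by (simp add: fourier_coeff_def expect_eq_average walsh_def cube_def)
next
  case (Suc n)
  let ?p = "fourier_coeff n (\<lambda>x. f (x(Suc n := 0)))"
  let ?q = "fourier_coeff n (\<lambda>x. f (x(Suc n := 1)))"
  have "(\<Sum>S\<in>Pow {1..Suc n}. (fourier_coeff (Suc n) f S)\<^sup>2) =
      (\<Sum>S\<in>Pow {1..n}. ((?p S + ?q S) / 2)\<^sup>2 + ((?p S - ?q S) / 2)\<^sup>2)"
    unfolding sum_Pow_Suc
    by (intro sum.cong) (simp_all only: fourier_coeff_Suc fourier_coeff_Suc_insert Pow_iff)
  also have "\<dots> = (\<Sum>S\<in>Pow {1..n}. ((?p S)\<^sup>2 + (?q S)\<^sup>2) / 2)"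
    by (intro sum.cong) (auto simp: power2_eq_square field_simps)
  also have "\<dots> = ((\<Sum>S\<in>Pow {1..n}. (?p S)\<^sup>2) + (\<Sum>S\<in>Pow {1..n}. (?q S)\<^sup>2)) / 2"
    by (simp only: sum.distrib flip: sum_divide_distrib)
  finally show ?case
    by (simp only: Suc.IH expect_Suc)
qed

section \<open>Products of Fourier coefficients of two indicators\<close>

lemma abs_walsh: "\<bar>walsh S x\<bar> = 1"
  by (simp add: walsh_def power_abs)

lemma abs_fourier_coeff_le:
  assumes "\<And>x. x \<in> cube n \<Longrightarrow> f x \<ge> 0"
  shows "\<bar>fourier_coeff n f S\<bar> \<le> expect n f"
proof -
  have "\<bar>\<Sum>x\<in>cube n. f x * walsh S x\<bar> \<le> (\<Sum>x\<in>cube n. \<bar>f x * walsh S x\<bar>)"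
    by (rule sum_abs)
  also have "\<dots> = (\<Sum>x\<in>cube n. f x)"
    using assms by (intro sum.cong) (auto simp: abs_mult abs_walsh)
  finally show ?thesis
    by (simp add: fourier_coeff_def expect_eq_average divide_right_mono)
qed

text \<open>The coefficients of \<open>A\<close> are bounded uniformly by its mean, those of
  \<open>B\<close> are summed by Parseval. The bound is asymmetric, and it is sharper when
  \<open>A\<close> is the indicator with the smaller mean.\<close>

lemma sum_fourier_coeff_squares_le:
  assumes A: "A \<in> cube n \<rightarrow> {0, 1}" and B: "B \<in> cube n \<rightarrow> {0, 1}"
  shows "(\<Sum>S\<in>Pow {1..n}. (fourier_coeff n A S)\<^sup>2 * (fourier_coeff n B S)\<^sup>2)
    \<le> (expect n A)\<^sup>2 * expect n B"
proof -
  have nonneg: "A x \<ge> 0" if "x \<in> cube n" for x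
    using funcset_mem [OF A that] by auto
  have "(\<Sum>S\<in>Pow {1..n}. (fourier_coeff n A S)\<^sup>2 * (fourier_coeff n B S)\<^sup>2)
      \<le> (\<Sum>S\<in>Pow {1..n}. (expect n A)\<^sup>2 * (fourier_coeff n B S)\<^sup>2)"
    using power_mono [OF abs_fourier_coeff_le [OF nonneg] abs_ge_zero, where n = 2]
    by (intro sum_mono mult_right_mono) auto
  also have "\<dots> = (expect n A)\<^sup>2 * expect n (\<lambda>x. (B x)\<^sup>2)"
    by (simp only: parseval flip: sum_distrib_left)
  also have "expect n (\<lambda>x. (B x)\<^sup>2) = expect n B"
    using B by (intro expect_cong) force
  finally show ?thesis .
qed

text \<open>Here \<open>a\<close> and \<open>b\<close> stand for the means of two indicators and
  \<open>c\<close> for the mean of their product. For \<open>a \<le> 1 / 2\<close> the term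
  \<open>a * b\<close> suffices; for larger \<open>a\<close> the bound
  \<open>a + b - 1 \<le> c\<close> supplies the rest.\<close>

lemma indicator_mean_inequality:
  fixes a b c :: real
  assumes "0 \<le> a" "a \<le> b" "b \<le> 1" "0 \<le> c" "a + b - 1 \<le> c"
  shows "2 * (a\<^sup>2 * b) \<le> a * b + c"
proof (cases "a \<le> 1 / 2")
  case True
  have "a * b * (2 * a) \<le> a * b * 1"
    using True assms by (intro mult_left_mono) auto
  then show ?thesis
    using assms by (simp add: power2_eq_square algebra_simps)
next
  case False
  \<comment> \<open>The slack is affine in \<open>b\<close>, with value
    \<open>2 * a * (1 - a)\<close> at \<open>b = 1\<close> and
    \<open>(2 * a - 1) * (1 + a) * (1 - a)\<close> at \<open>b = a\<close>. This is its
    interpolation between these points, with \<open>1 - a\<close> cancelled.\<close>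
  have "0 \<le> (b - a) * (2 * a) + (1 - b) * ((2 * a - 1) * (1 + a))"
    using False assms by (intro add_nonneg_nonneg mult_nonneg_nonneg) auto
  also have "\<dots> = a * b + (a + b - 1) - 2 * (a\<^sup>2 * b)"
    by (simp add: power2_eq_square algebra_simps)
  finally show ?thesis
    using assms by linarith
qed

lemma sum_indicator_fourier_coeff_le:
  assumes A: "A \<in> cube n \<rightarrow> {0, 1}" and B: "B \<in> cube n \<rightarrow> {0, 1}"
  shows "2 * (\<Sum>S\<in>Pow {1..n}. (fourier_coeff n A S)\<^sup>2 * (fourier_coeff n B S)\<^sup>2)
    \<le> expect n A * expect n B + expect n (\<lambda>x. A x * B x)"
proof -
  have bounds: "0 \<le> expect n h" "expect n h \<le> 1" if "h \<in> cube n \<rightarrow> {0, 1}" for h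
  proof -
    have "0 \<le> h x \<and> h x \<le> 1" if "x \<in> cube n" for x
      using funcset_mem [OF \<open>h \<in> cube n \<rightarrow> {0, 1}\<close> that] by auto
    then show "0 \<le> expect n h" "expect n h \<le> 1"
      using expect_mono [of n "\<lambda>_. 0" h] expect_mono [of n h "\<lambda>_. 1"] by (auto simp: expect_const)
  qed
  have AB: "(\<lambda>x. A x * B x) \<in> cube n \<rightarrow> {0, 1}"
    using A B by fastforce
  have "expect n (\<lambda>x. A x + B x - 1) \<le> expect n (\<lambda>x. A x * B x)"
  proof (rule expect_mono)
    fix x assume "x \<in> cube n"
    then have "A x \<in> {0, 1}" "B x \<in> {0, 1}"
      using A B by auto
    then show "A x + B x - 1 \<le> A x * B x"
      by auto
  qed
  then have union: "expect n A + expect n B - 1 \<le> expect n (\<lambda>x. A x * B x)"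
    by (simp add: expect_diff expect_add expect_const)
  show ?thesis
  proof (cases "expect n A \<le> expect n B")
    case True
    then show ?thesis
      using sum_fourier_coeff_squares_le [OF A B] union bounds [OF A] bounds [OF B] bounds [OF AB]
        indicator_mean_inequality [of "expect n A" "expect n B" "expect n (\<lambda>x. A x * B x)"]
      by linarith
  next
    case False
    then show ?thesis
      using sum_fourier_coeff_squares_le [OF B A] union bounds [OF A] bounds [OF B] bounds [OF AB]
        indicator_mean_inequality [of "expect n B" "expect n A" "expect n (\<lambda>x. A x * B x)"]
      by (simp add: mult.commute)
  qed
qed

section \<open>Recursions for covariance and energy\<close>

text \<open>Law of total covariance, conditioning on the last coordinate: the mean of the
  conditional covariances plus the covariance of the conditional means.\<close>

lemma Cov_Suc:
  "Cov (Suc n) f g =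
    (Cov n (\<lambda>x. f (x(Suc n := 0))) (\<lambda>x. g (x(Suc n := 0)))
     + Cov n (\<lambda>x. f (x(Suc n := 1))) (\<lambda>x. g (x(Suc n := 1)))) / 2
    + expect n (\<lambda>x. f (x(Suc n := 1)) - f (x(Suc n := 0)))
      * expect n (\<lambda>x. g (x(Suc n := 1)) - g (x(Suc n := 0))) / 4"
  by (simp add: Cov_def expect_Suc expect_diff field_simps)

lemma Cov_diff_diff:
  "Cov n (\<lambda>x. f1 x - f0 x) (\<lambda>x. g1 x - g0 x) =
    Cov n f0 g0 + Cov n f1 g1 - Cov n f0 g1 - Cov n f1 g0"
  by (simp add: Cov_def expect_diff expect_add algebra_simps)

text \<open>Up to normalization, the Dirichlet energy of the convolution of \<open>f\<close> and
  \<open>g\<close> on the group of bit vectors. The empty set has weight 0; keeping it makes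
  \<open>sum_Pow_Suc\<close> applicable.\<close>

definition energy :: "nat \<Rightarrow> ((nat \<Rightarrow> nat) \<Rightarrow> real) \<Rightarrow> ((nat \<Rightarrow> nat) \<Rightarrow> real) \<Rightarrow> real" where
  "energy n f g =
    (\<Sum>S\<in>Pow {1..n}. real (card S) * (fourier_coeff n f S)\<^sup>2 * (fourier_coeff n g S)\<^sup>2)"

text \<open>With \<open>k = card S\<close>, the left side collects the terms at \<open>S\<close> and
  \<open>insert (Suc n) S\<close>. The extra 1 in \<open>k + 1\<close> yields the last summand, and
  the whole defect is the square \<open>k * (p * r - q * s)\<^sup>2 / 4\<close>.\<close>

lemma four_product_le:
  fixes k p q r s :: real
  assumes "0 \<le> k"
  shows "k * ((p + q) / 2)\<^sup>2 * ((r + s) / 2)\<^sup>2 + (k + 1) * ((p - q) / 2)\<^sup>2 * ((r - s) / 2)\<^sup>2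
    \<le> (3 * (k * p\<^sup>2 * r\<^sup>2 + k * q\<^sup>2 * s\<^sup>2) + k * p\<^sup>2 * s\<^sup>2 + k * q\<^sup>2 * r\<^sup>2) / 8
      + (q - p)\<^sup>2 * (s - r)\<^sup>2 / 16"
proof -
  have "0 \<le> k * (p * r - q * s)\<^sup>2 / 4"
    using assms by simp
  also have "\<dots> =
      (3 * (k * p\<^sup>2 * r\<^sup>2 + k * q\<^sup>2 * s\<^sup>2) + k * p\<^sup>2 * s\<^sup>2 + k * q\<^sup>2 * r\<^sup>2) / 8
      + (q - p)\<^sup>2 * (s - r)\<^sup>2 / 16
      - (k * ((p + q) / 2)\<^sup>2 * ((r + s) / 2)\<^sup>2 + (k + 1) * ((p - q) / 2)\<^sup>2 * ((r - s) / 2)\<^sup>2)"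
    by (simp add: power2_eq_square field_simps)
  finally show ?thesis
    by simp
qed

lemma energy_Suc_le:
  fixes n :: nat and f g :: "(nat \<Rightarrow> nat) \<Rightarrow> real"
  defines "f0 \<equiv> \<lambda>x. f (x(Suc n := 0))" and "f1 \<equiv> \<lambda>x. f (x(Suc n := 1))"
    and "g0 \<equiv> \<lambda>x. g (x(Suc n := 0))" and "g1 \<equiv> \<lambda>x. g (x(Suc n := 1))"
  defines "Q \<equiv> \<Sum>S\<in>Pow {1..n}. (fourier_coeff n (\<lambda>x. f1 x - f0 x) S)\<^sup>2
    * (fourier_coeff n (\<lambda>x. g1 x - g0 x) S)\<^sup>2"
  shows "energy (Suc n) f g \<le>
      (3 * (energy n f0 g0 + energy n f1 g1) + energy n f0 g1 + energy n f1 g0) / 8 + Q / 16"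
proof -
  let ?p = "fourier_coeff n f0" and ?q = "fourier_coeff n f1"
  let ?r = "fourier_coeff n g0" and ?s = "fourier_coeff n g1"
  have card: "card (insert (Suc n) S) = Suc (card S)" if "S \<in> Pow {1..n}" for S
  proof -
    have "finite S" "Suc n \<notin> S"
      using that finite_subset by auto
    then show ?thesis by simp
  qed
  have E: "energy (Suc n) f g = (\<Sum>S\<in>Pow {1..n}.
      real (card S) * ((?p S + ?q S) / 2)\<^sup>2 * ((?r S + ?s S) / 2)\<^sup>2
      + (real (card S) + 1) * ((?p S - ?q S) / 2)\<^sup>2 * ((?r S - ?s S) / 2)\<^sup>2)"
    unfolding energy_def sum_Pow_Suc
    by (intro sum.cong)
      (simp_all only: card fourier_coeff_Suc fourier_coeff_Suc_insert Pow_iff of_nat_Suc add.commute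
        f0_def f1_def g0_def g1_def)
  have "energy (Suc n) f g \<le> (\<Sum>S\<in>Pow {1..n}.
      (3 * (real (card S) * (?p S)\<^sup>2 * (?r S)\<^sup>2 + real (card S) * (?q S)\<^sup>2 * (?s S)\<^sup>2)
       + real (card S) * (?p S)\<^sup>2 * (?s S)\<^sup>2 + real (card S) * (?q S)\<^sup>2 * (?r S)\<^sup>2) / 8
      + (?q S - ?p S)\<^sup>2 * (?s S - ?r S)\<^sup>2 / 16)"
    unfolding E by (intro sum_mono four_product_le of_nat_0_le_iff)
  then show "energy (Suc n) f g \<le>
      (3 * (energy n f0 g0 + energy n f1 g1) + energy n f0 g1 + energy n f1 g0) / 8 + Q / 16"
    by (simp only: energy_def Q_def fourier_coeff_diff sum.distrib
        flip: sum_divide_distrib sum_distrib_left)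
qed

text \<open>The induction is over all pairs at once, since the mixed pairs of restrictions to
  opposite facets also need the hypothesis.\<close>

lemma energy_le_Cov:
  assumes "f \<in> cube n \<rightarrow> {0, 1}" "g \<in> cube n \<rightarrow> {0, 1}"
    and "mono_on (cube n) f" "mono_on (cube n) g"
  shows "4 * energy n f g \<le> Cov n f g"
  using assms
proof (induction n arbitrary: f g)
  case 0
  then show ?case
    by (simp add: energy_def Cov_def expect_eq_average cube_def)
next
  case (Suc n)
  have restrict: "(\<lambda>x. h (x(Suc n := v))) \<in> cube n \<rightarrow> {0, 1}"
      "mono_on (cube n) (\<lambda>x. h (x(Suc n := v)))"
    if "h \<in> cube (Suc n) \<rightarrow> {0, 1}" "mono_on (cube (Suc n)) h" "v \<in> {0, 1}"
    for h :: "(nat \<Rightarrow> nat) \<Rightarrow> real" and v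
  proof -
    show "(\<lambda>x. h (x(Suc n := v))) \<in> cube n \<rightarrow> {0, 1}"
      using that(1) fun_upd_mem_cube [OF _ that(3)] by fast
    show "mono_on (cube n) (\<lambda>x. h (x(Suc n := v)))"
      by (intro mono_onI mono_onD [OF that(2)] fun_upd_mem_cube that(3)) (auto simp: le_fun_def)
  qed
  \<comment> \<open>Monotonicity excludes the value -1, so the discrete derivative is an
    indicator.\<close>
  have difference: "(\<lambda>x. h (x(Suc n := 1)) - h (x(Suc n := 0))) \<in> cube n \<rightarrow> {0, 1}"
    if "h \<in> cube (Suc n) \<rightarrow> {0, 1}" "mono_on (cube (Suc n)) h" for h :: "(nat \<Rightarrow> nat) \<Rightarrow> real"
  proof
    fix x assume x: "x \<in> cube n"
    have mem: "x(Suc n := 0) \<in> cube (Suc n)" "x(Suc n := 1) \<in> cube (Suc n)"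
      using x by (auto intro: fun_upd_mem_cube)
    have "h (x(Suc n := 0)) \<le> h (x(Suc n := 1))"
      using mem by (intro mono_onD [OF that(2)]) (auto simp: le_fun_def)
    then show "h (x(Suc n := 1)) - h (x(Suc n := 0)) \<in> {0, 1}"
      using funcset_mem [OF that(1) mem(1)] funcset_mem [OF that(1) mem(2)] by auto
  qed
  define f0 f1 where "f0 = (\<lambda>x. f (x(Suc n := 0)))" and "f1 = (\<lambda>x. f (x(Suc n := 1)))"
  define g0 g1 where "g0 = (\<lambda>x. g (x(Suc n := 0)))" and "g1 = (\<lambda>x. g (x(Suc n := 1)))"
  define A B where "A = (\<lambda>x. f1 x - f0 x)" and "B = (\<lambda>x. g1 x - g0 x)"
  define Q where "Q = (\<Sum>S\<in>Pow {1..n}. (fourier_coeff n A S)\<^sup>2 * (fourier_coeff n B S)\<^sup>2)"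
  have IH: "4 * energy n f0 g0 \<le> Cov n f0 g0" "4 * energy n f0 g1 \<le> Cov n f0 g1"
    "4 * energy n f1 g0 \<le> Cov n f1 g0" "4 * energy n f1 g1 \<le> Cov n f1 g1"
    unfolding f0_def f1_def g0_def g1_def by (intro Suc restrict; simp)+
  have "A \<in> cube n \<rightarrow> {0, 1}" "B \<in> cube n \<rightarrow> {0, 1}"
    unfolding A_def B_def f0_def f1_def g0_def g1_def by (intro difference Suc.prems)+
  then have Q: "2 * Q \<le> 2 * (expect n A * expect n B) + Cov n A B"
    using sum_indicator_fourier_coeff_le unfolding Q_def Cov_def by fastforce
  have C: "Cov (Suc n) f g = (Cov n f0 g0 + Cov n f1 g1) / 2 + expect n A * expect n B / 4"
    unfolding A_def B_def f0_def f1_def g0_def g1_def by (rule Cov_Suc)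
  have D: "Cov n A B = Cov n f0 g0 + Cov n f1 g1 - Cov n f0 g1 - Cov n f1 g0"
    unfolding A_def B_def by (rule Cov_diff_diff)
  have "energy (Suc n) f g \<le>
      (3 * (energy n f0 g0 + energy n f1 g1) + energy n f0 g1 + energy n f1 g0) / 8 + Q / 16"
    unfolding Q_def A_def B_def f0_def f1_def g0_def g1_def by (rule energy_Suc_le)
  with IH have "4 * energy (Suc n) f g \<le>
      (3 * (Cov n f0 g0 + Cov n f1 g1) + Cov n f0 g1 + Cov n f1 g0) / 8 + Q / 4"
    by (simp add: field_simps)
  \<comment> \<open>Replacing the cross covariances via \<open>D\<close> leaves exactly the first
    term of \<open>C\<close>. What remains is
    \<open>Q / 4 - Cov n A B / 8 \<le> expect n A * expect n B / 4\<close>, which is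
    \<open>Q\<close> bounded as above, divided by 8.\<close>
  also have "\<dots> = (Cov n f0 g0 + Cov n f1 g1) / 2 - Cov n A B / 8 + Q / 4"
    unfolding D by (simp add: field_simps)
  also have "\<dots> \<le> Cov (Suc n) f g"
    unfolding C using Q by (simp add: field_simps)
  finally show ?case .
qed

theorem theorem1p1:
  fixes n :: nat and f g :: "(nat \<Rightarrow> nat) \<Rightarrow> real"
  assumes "f \<in> cube n \<rightarrow> {0, 1}" and "g \<in> cube n \<rightarrow> {0, 1}"
    and "mono_on (cube n) f" and "mono_on (cube n) g"
  shows "Cov n f g \<ge> 4 * (\<Sum>S\<in>Pow {1..n} - {{}}.
           real (card S) * (fourier_coeff n f S)\<^sup>2 * (fourier_coeff n g S)\<^sup>2)"
proof -
  have "(\<Sum>S\<in>Pow {1..n} - {{}}. real (card S) * (fourier_coeff n f S)\<^sup>2 * (fourier_coeff n g S)\<^sup>2)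
      = energy n f g"
    unfolding energy_def by (intro sum.mono_neutral_left) auto
  with energy_le_Cov [OF assms] show ?thesis
    by simp
qed

end
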